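(* Let $p,\mu:(0,\infty)\to(0,\infty)$ be smooth with $p'(v)<0$, $p''(v)\ge 0$ for all $v>0$, and $p''$ not identically zero on any interval. Let $v_\pm>0$, $u_\pm\in\mathbb{R}$ and $s<0$ satisfy the Rankine-Hugoniot conditions $$-s(v_+-v_-)=u_+-u_-,\qquad -s(u_+-u_-)=-(p(v_+)-p(v_-)),$$ and the entropy condition $v_->v_+$, $u_->u_+$. Then there exists a smooth solution $(\tilde v,\tilde u)(\xi)$, $\xi\in\mathbb{R}$, with $\tilde v>0$, of $$\begin{cases} -s\tilde v_\xi-\tilde u_\xi=0,\\ -s\tilde u_\xi+p(\tilde v)_\xi=\left(\dfrac{\mu(\tilde v)\,\tilde u_\xi}{\tilde v}\right)_\xi,\\ (\tilde v,\tilde u)(\pm\infty)=(v_\pm,u_\pm),\end{cases}$$ and it is unique up to a shift $\xi\mapsto\xi+\alpha$ ($\alpha\in\mathbb{R}$). Moreover, $\tilde u'(\xi)\le 0$ for all $\xi\in\mathbb{R}$.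
   Context: The profile $(\tilde v,\tilde u)(x-st)$ is the viscous shock wave (traveling wave, with $\xi=x-st$) of the one-dimensional isentropic Navier-Stokes equations in Lagrangian coordinates, $v_t-u_x=0$, $u_t+p(v)_x=\left(\frac{\mu(v)}{v}u_x\right)_x$, where $v>0$ is the specific volume, $u$ the velocity, $p$ the pressure and $\mu$ the viscosity coefficient. The notation $(\tilde v,\tilde u)(\pm\infty)=(v_\pm,u_\pm)$ means convergence as $\xi\to\pm\infty$. *)

theory Defs
  imports "HOL-Analysis.Analysis"
begin

text \<open>
  \<open>C\<^sup>\<infinity>\<close> on \<open>S\<close>, where \<open>S\<close> is meant to be open: derivatives are two-sided, so the values of \<open>f\<close>
  outside an open \<open>S\<close> are irrelevant. Continuity of the \<open>n\<close>-th derivative follows from its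
  differentiability.
\<close>

definition smooth_on :: "real set \<Rightarrow> (real \<Rightarrow> real) \<Rightarrow> bool" where
  "smooth_on S f \<longleftrightarrow> (\<forall>n. \<forall>x\<in>S. (deriv ^^ n) f differentiable (at x))"

definition viscous_shock ::
  "(real \<Rightarrow> real) \<Rightarrow> (real \<Rightarrow> real) \<Rightarrow> real \<Rightarrow> real \<Rightarrow> real \<Rightarrow> real \<Rightarrow> real
    \<Rightarrow> (real \<Rightarrow> real) \<Rightarrow> (real \<Rightarrow> real) \<Rightarrow> bool" where
  "viscous_shock p \<mu> s v_minus v_plus u_minus u_plus v u \<longleftrightarrow>
     smooth_on UNIV v \<and> smooth_on UNIV u \<and>
     (\<forall>\<xi>. v \<xi> > 0) \<and>
     (\<forall>\<xi>. - s * deriv v \<xi> - deriv u \<xi> = 0) \<and>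
     (\<forall>\<xi>. - s * deriv u \<xi> + deriv (\<lambda>x. p (v x)) \<xi>
          = deriv (\<lambda>x. \<mu> (v x) * deriv u x / v x) \<xi>) \<and>
     (v \<longlongrightarrow> v_minus) at_bot \<and> (u \<longlongrightarrow> u_minus) at_bot \<and>
     (v \<longlongrightarrow> v_plus) at_top \<and> (u \<longlongrightarrow> u_plus) at_top"

end

theory Submission
  imports Defs
begin

text \<open>
  Integrating both equations once reduces the system to \<open>u = u\<^sub>+ - s (v - v\<^sub>+)\<close> together with the
  scalar equation \<open>v' = f(v)\<close>, \<open>f(v) = v h(v) / (- s \<mu>(v))\<close>,
  \<open>h(v) = s\<^sup>2 (v - v\<^sub>+) + p(v) - p(v\<^sub>+)\<close>. By the Rankine-Hugoniot conditions \<open>h\<close> vanishes at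
  \<open>v\<^sub>\<plusminus>\<close>, and it is strictly convex, so \<open>f < 0\<close> in between: the shock profiles are exactly the
  orbits of the scalar equation from \<open>v\<^sub>-\<close> down to \<open>v\<^sub>+\<close>, of which there is one up to translation.
\<close>

section \<open>Smooth functions\<close>

text \<open>A finite-order form of \<open>smooth_on\<close>, so that closure properties can be
  proved by induction on the order. The recursion strips the innermost derivative, which lets the
  induction hypothesis be applied to \<open>deriv f\<close>.\<close>

primrec differentiable_times :: "nat \<Rightarrow> real set \<Rightarrow> (real \<Rightarrow> real) \<Rightarrow> bool" where
  "differentiable_times 0 S f \<longleftrightarrow> True"
| "differentiable_times (Suc n) S f \<longleftrightarrow>
     (\<forall>x\<in>S. f differentiable (at x)) \<and> differentiable_times n S (deriv f)"

lemma differentiable_times_iff: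
  "differentiable_times n S f \<longleftrightarrow> (\<forall>k<n. \<forall>x\<in>S. (deriv ^^ k) f differentiable (at x))"
proof (induction n arbitrary: f)
  case (Suc n)
  show ?case
    unfolding differentiable_times.simps Suc.IH All_less_Suc2
    by (simp add: funpow_Suc_right del: funpow.simps(2))
qed simp

lemma smooth_on_iff: "smooth_on S f \<longleftrightarrow> (\<forall>n. differentiable_times n S f)"
  unfolding smooth_on_def differentiable_times_iff by blast

lemma deriv_cong_open:
  fixes f g :: "real \<Rightarrow> real"
  assumes "open S" "x \<in> S" "\<And>x. x \<in> S \<Longrightarrow> f x = g x"
  shows "deriv f x = deriv g x"
proof (rule deriv_cong_ev)
  show "\<forall>\<^sub>F x in nhds x. f x = g x"
    using assms unfolding eventually_nhds by blast
qed simp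

text \<open>On an open set a derivative sees only values inside the set, so agreement of
  \<open>f\<close> and \<open>g\<close> passes on to their derivatives and the induction
  proceeds.\<close>

lemma differentiable_times_cong:
  assumes "open S" "\<And>x. x \<in> S \<Longrightarrow> f x = g x" "differentiable_times n S f"
  shows "differentiable_times n S g"
  using assms(2,3)
proof (induction n arbitrary: f g)
  case (Suc n)
  have "g differentiable (at x)" if "x \<in> S" for x
  proof -
    have "(f has_real_derivative deriv f x) (at x)"
      using Suc.prems that by (simp add: DERIV_deriv_iff_real_differentiable)
    then have "(g has_real_derivative deriv f x) (at x)"
      by (rule has_field_derivative_transform_within_open[OF _ assms(1) that]) (rule Suc.prems(1))
    then show ?thesis
      using real_differentiable_def by blast
  qed
  moreover have "differentiable_times n S (deriv g)"
  proof (rule Suc.IH)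
    show "deriv f x = deriv g x" if "x \<in> S" for x
      using assms(1) that Suc.prems(1) by (rule deriv_cong_open)
  qed (use Suc.prems(2) in simp)
  ultimately show ?case by simp
qed simp

text \<open>Lets later inductions use an explicit formula \<open>g\<close> for the derivative. Since
  \<open>deriv f\<close> equals \<open>g\<close> only on \<open>S\<close>, the congruence lemma is
  what transfers the regularity.\<close>

lemma differentiable_times_SucI:
  assumes "open S" "\<And>x. x \<in> S \<Longrightarrow> (f has_real_derivative g x) (at x)" "differentiable_times n S g"
  shows "differentiable_times (Suc n) S f"
proof -
  have "differentiable_times n S (deriv f)"
    using assms(2) by (intro differentiable_times_cong[OF assms(1) _ assms(3)]) (metis DERIV_imp_deriv)
  then show ?thesis
    using assms(2) real_differentiable_def by auto
qed

lemma differentiable_times_lower: "differentiable_times (Suc n) S f \<Longrightarrow> differentiable_times n S f"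
  unfolding differentiable_times_iff by simp

lemma differentiable_times_add:
  assumes "open S" "differentiable_times n S f" "differentiable_times n S g"
  shows "differentiable_times n S (\<lambda>x. f x + g x)"
  using assms(2,3)
proof (induction n arbitrary: f g)
  case (Suc n)
  show ?case
    by (rule differentiable_times_SucI[OF assms(1), where g = "\<lambda>x. deriv f x + deriv g x"])
      (use Suc in \<open>auto intro!: DERIV_add simp: DERIV_deriv_iff_real_differentiable\<close>)
qed simp

lemma differentiable_times_mult:
  assumes "open S" "differentiable_times n S f" "differentiable_times n S g"
  shows "differentiable_times n S (\<lambda>x. f x * g x)"
  using assms(2,3)
proof (induction n arbitrary: f g)
  case (Suc n)
  show ?case
  proof (rule differentiable_times_SucI[OF assms(1)])
    show "((\<lambda>x. f x * g x) has_real_derivative deriv f x * g x + deriv g x * f x) (at x)"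
      if "x \<in> S" for x
      using Suc.prems that by (intro DERIV_mult) (auto simp: DERIV_deriv_iff_real_differentiable)
    show "differentiable_times n S (\<lambda>x. deriv f x * g x + deriv g x * f x)"
      \<comment> \<open>The product rule keeps one factor undifferentiated; its order has to be
        lowered by one to match that of the differentiated factor.\<close>
      using Suc.prems(1,2)[THEN differentiable_times_lower] Suc.prems
      by (intro differentiable_times_add[OF assms(1)] Suc.IH) simp_all
  qed
qed simp

section \<open>Closure properties of smooth functions\<close>

lemma DERIV_smooth_on:
  "smooth_on S f \<Longrightarrow> x \<in> S \<Longrightarrow> (f has_real_derivative deriv f x) (at x)"
  unfolding smooth_on_def DERIV_deriv_iff_real_differentiable by (metis funpow_0)

lemma smooth_on_deriv: "smooth_on S f \<Longrightarrow> smooth_on S (deriv f)"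
  unfolding smooth_on_iff by (metis differentiable_times.simps(2))

lemma smooth_on_const: "smooth_on S (\<lambda>x. c)"
proof -
  have "differentiable_times n S (\<lambda>x. c)" for n
    by (induction n arbitrary: c) auto
  then show ?thesis by (simp add: smooth_on_iff)
qed

lemma smooth_on_id: "smooth_on S (\<lambda>x. x)"
proof -
  have "differentiable_times n S (\<lambda>x. x)" for n
    using smooth_on_const[of S 1] by (cases n) (auto simp: smooth_on_iff)
  then show ?thesis by (simp add: smooth_on_iff)
qed

lemma smooth_on_add:
  "open S \<Longrightarrow> smooth_on S f \<Longrightarrow> smooth_on S g \<Longrightarrow> smooth_on S (\<lambda>x. f x + g x)"
  by (simp add: smooth_on_iff differentiable_times_add)

lemma smooth_on_mult:
  "open S \<Longrightarrow> smooth_on S f \<Longrightarrow> smooth_on S g \<Longrightarrow> smooth_on S (\<lambda>x. f x * g x)"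
  by (simp add: smooth_on_iff differentiable_times_mult)

text \<open>The derivative of \<open>1/f\<close> is a product of \<open>-1\<close>,
  \<open>f'\<close> and two copies of \<open>1/f\<close>, so order \<open>n\<close> of
  \<open>1/f\<close> yields order \<open>n + 1\<close> by the product lemma alone.\<close>

lemma smooth_on_inverse:
  assumes "open S" "smooth_on S f" "\<And>x. x \<in> S \<Longrightarrow> f x \<noteq> 0"
  shows "smooth_on S (\<lambda>x. inverse (f x))"
proof -
  have "differentiable_times n S (\<lambda>x. inverse (f x))" for n
  proof (induction n)
    case (Suc n)
    show ?case
    proof (rule differentiable_times_SucI[OF assms(1)])
      show "((\<lambda>x. inverse (f x)) has_real_derivative
          - 1 * (inverse (f x) * (deriv f x * inverse (f x)))) (at x)" if "x \<in> S" for x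
        using DERIV_inverse'[OF DERIV_smooth_on[OF assms(2) that] assms(3)[OF that]]
        by (simp add: mult.assoc)
      show "differentiable_times n S (\<lambda>x. - 1 * (inverse (f x) * (deriv f x * inverse (f x))))"
        using Suc smooth_on_const[of S "-1"] smooth_on_deriv[OF assms(2)]
        by (intro differentiable_times_mult[OF assms(1)]) (auto simp only: smooth_on_iff)
    qed
  qed simp
  then show ?thesis by (simp add: smooth_on_iff)
qed

lemma smooth_on_divide:
  assumes "open S" "smooth_on S f" "smooth_on S g" "\<And>x. x \<in> S \<Longrightarrow> g x \<noteq> 0"
  shows "smooth_on S (\<lambda>x. f x / g x)"
  unfolding divide_inverse using assms by (intro smooth_on_mult smooth_on_inverse)

text \<open>The functions \<open>g \<circ> v\<close> with \<open>g\<close> smooth are closed under differentiation along the flow.\<close>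

lemma smooth_on_ode_solution:
  assumes f: "smooth_on S f" and S: "open S" and v: "\<And>t. v t \<in> S"
    and ode: "\<And>t. (v has_real_derivative f (v t)) (at t)"
  shows "smooth_on UNIV v"
proof -
  have "differentiable_times n UNIV (\<lambda>t. g (v t))" if "smooth_on S g" for n g
    using that
  proof (induction n arbitrary: g)
    case (Suc n)
    show ?case
      by (rule differentiable_times_SucI[where g = "\<lambda>t. deriv g (v t) * f (v t)"])
        (use DERIV_chain2[OF DERIV_smooth_on[OF Suc.prems v] ode]
          Suc.IH[OF smooth_on_mult[OF S smooth_on_deriv[OF Suc.prems] f]] in auto)
  qed simp
  from this[OF smooth_on_id] show ?thesis by (simp add: smooth_on_iff)
qed

text \<open>\<open>deriv f\<close> is itself differentiable, hence continuous and bounded on the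
  compact interval; the mean value inequality does the rest. This serves both uniqueness and the
  linear bounds of the vector field at its zeros.\<close>

lemma smooth_on_imp_lipschitz:
  fixes f :: "real \<Rightarrow> real"
  assumes f: "smooth_on S f" and ab: "{a..b} \<subseteq> S"
  shows "\<exists>L>0. \<forall>x\<in>{a..b}. \<forall>y\<in>{a..b}. \<bar>f x - f y\<bar> \<le> L * \<bar>x - y\<bar>"
proof -
  have "continuous_on {a..b} (deriv f)"
    using DERIV_smooth_on[OF smooth_on_deriv[OF f]] ab
    by (intro continuous_at_imp_continuous_on) (meson DERIV_isCont subsetD)
  then have "bounded (deriv f ` {a..b})"
    by (intro compact_imp_bounded compact_continuous_image) auto
  then obtain L where L: "L > 0" "\<And>x. x \<in> {a..b} \<Longrightarrow> norm (deriv f x) \<le> L"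
    unfolding bounded_pos by auto
  have "norm (f x - f y) \<le> L * norm (x - y)" if "x \<in> {a..b}" "y \<in> {a..b}" for x y
  proof (rule field_differentiable_bound[where S = "{a..b}" and f' = "deriv f"])
    show "(f has_real_derivative deriv f z) (at z within {a..b})" if "z \<in> {a..b}" for z
      using DERIV_smooth_on[OF f] ab that by (blast intro: has_field_derivative_at_within)
  qed (use that L(2) in auto)
  with L(1) show ?thesis by (intro exI[of _ L]) (auto simp: real_norm_def)
qed

section \<open>Scalar autonomous equations\<close>

text \<open>Gronwall argument: the weighted square \<open>exp (-2 L x) (v - w)^2\<close> is
  nonincreasing because the Lipschitz bound controls the growth of \<open>(v - w)^2\<close>, and it
  starts at zero.\<close>

lemma ode_unique_forward:
  fixes f v w :: "real \<Rightarrow> real"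
  assumes lip: "\<And>x y. x \<in> {c..d} \<Longrightarrow> y \<in> {c..d} \<Longrightarrow> \<bar>f x - f y\<bar> \<le> L * \<bar>x - y\<bar>"
    and v: "\<And>x. a \<le> x \<Longrightarrow> x \<le> b \<Longrightarrow> (v has_real_derivative f (v x)) (at x) \<and> v x \<in> {c..d}"
    and w: "\<And>x. a \<le> x \<Longrightarrow> x \<le> b \<Longrightarrow> (w has_real_derivative f (w x)) (at x) \<and> w x \<in> {c..d}"
    and eq: "v a = w a" and "a \<le> b"
  shows "v b = w b"
proof -
  define y where "y x = exp (- (2 * L * x)) * (v x - w x)\<^sup>2" for x
  have "y b \<le> y a"
  proof (rule DERIV_nonpos_imp_nonincreasing[OF \<open>a \<le> b\<close>])
    fix x assume x: "a \<le> x" "x \<le> b"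
    let ?D = "2 * exp (- (2 * L * x)) * ((v x - w x) * (f (v x) - f (w x)) - L * (v x - w x)\<^sup>2)"
    have "(y has_real_derivative ?D) (at x)"
      unfolding y_def using v[OF x] w[OF x]
      by (auto intro!: derivative_eq_intros simp: algebra_simps power2_eq_square)
    moreover have "(v x - w x) * (f (v x) - f (w x)) \<le> \<bar>v x - w x\<bar> * \<bar>f (v x) - f (w x)\<bar>"
      by (metis abs_ge_self abs_mult)
    moreover have "\<dots> \<le> \<bar>v x - w x\<bar> * (L * \<bar>v x - w x\<bar>)"
      using lip v[OF x] w[OF x] by (intro mult_left_mono) auto
    moreover have "\<dots> = L * (v x - w x)\<^sup>2"
      by (simp add: power2_eq_square)
    ultimately show "\<exists>D. (y has_real_derivative D) (at x) \<and> D \<le> 0"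
      by (intro exI[of _ ?D]) (auto simp: mult_le_0_iff)
  qed
  then have "(v b - w b)\<^sup>2 \<le> 0"
    by (simp add: y_def eq mult_le_0_iff)
  then show ?thesis by simp
qed

text \<open>\<open>f\<close> is Lipschitz only on compact subintervals of the half line. Between the
  times \<open>a\<close> and \<open>t\<close> both solutions stay in such an interval
  \<open>{c..d}\<close>, so the Gronwall argument applies there.\<close>

lemma ode_unique:
  fixes f v w :: "real \<Rightarrow> real"
  assumes f: "smooth_on {0<..} f" and pos: "\<And>x. v x > 0" "\<And>x. w x > 0"
    and v: "\<And>x. (v has_real_derivative f (v x)) (at x)"
    and w: "\<And>x. (w has_real_derivative f (w x)) (at x)"
    and eq: "v a = w a"
  shows "v = w"
proof
  fix t
  define A B where "A = min a t" and "B = max a t"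
  have "compact (v ` {A..B} \<union> w ` {A..B})"
    using DERIV_isCont[OF v] DERIV_isCont[OF w]
    by (intro compact_Un compact_continuous_image continuous_at_imp_continuous_on) auto
  moreover have "v ` {A..B} \<union> w ` {A..B} \<noteq> {}"
    by (auto simp: A_def B_def)
  ultimately obtain c d where c: "c \<in> v ` {A..B} \<union> w ` {A..B}" "\<forall>y\<in>v ` {A..B} \<union> w ` {A..B}. c \<le> y"
    and d: "\<forall>y\<in>v ` {A..B} \<union> w ` {A..B}. y \<le> d"
    by (meson compact_attains_inf compact_attains_sup)
  \<comment> \<open>The minimum is attained by one of the two positive solutions, so
    \<open>{c..d}\<close> stays away from the boundary of the domain.\<close>
  have "c > 0"
    using c(1) pos by auto
  then have "{c..d} \<subseteq> {0<..}"
    by auto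
  then obtain L where "L > 0"
    and L: "\<And>x y. x \<in> {c..d} \<Longrightarrow> y \<in> {c..d} \<Longrightarrow> \<bar>f x - f y\<bar> \<le> L * \<bar>x - y\<bar>"
    using smooth_on_imp_lipschitz[OF f] by meson
  have range: "v x \<in> {c..d} \<and> w x \<in> {c..d}" if "A \<le> x" "x \<le> B" for x
    using that c(2) d by auto
  show "v t = w t"
  proof (cases "a \<le> t")
    case True
    then have "A = a" "B = t"
      by (auto simp: A_def B_def)
    then show ?thesis
      using v w range by (intro ode_unique_forward[where f = f and v = v and w = w, OF L _ _ eq True]) auto
  next
    case False
    then have AB: "A = t" "B = a"
      by (auto simp: A_def B_def)
    \<comment> \<open>For times before \<open>a\<close>, time reversal yields solutions for the
      field \<open>-f\<close>, which has the same Lipschitz constant.\<close>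
    have reflect: "((\<lambda>x. u (- x)) has_real_derivative - f (u (- x))) (at x)"
      if "\<And>x. (u has_real_derivative f (u x)) (at x)" for u x
      using that[of "- x"] by (simp add: DERIV_mirror)
    have "v (- (- t)) = w (- (- t))"
    proof (rule ode_unique_forward[where a = "- a" and f = "\<lambda>y. - f y" and v = "\<lambda>x. v (- x)"
          and w = "\<lambda>x. w (- x)" and L = L and c = c and d = d])
      show "\<bar>- f x - - f y\<bar> \<le> L * \<bar>x - y\<bar>" if "x \<in> {c..d}" "y \<in> {c..d}" for x y
        using L[OF that] by simp
      show "((\<lambda>x. v (- x)) has_real_derivative - f (v (- x))) (at x) \<and> v (- x) \<in> {c..d}"
        and "((\<lambda>x. w (- x)) has_real_derivative - f (w (- x))) (at x) \<and> w (- x) \<in> {c..d}"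
        if "- a \<le> x" "x \<le> - t" for x
        using that reflect v w range[of "- x"] by (auto simp: AB)
    qed (use False eq in auto)
    then show ?thesis by simp
  qed
qed

text \<open>
  The solution is the inverse of a primitive \<open>G\<close> of \<open>1/f\<close>. By the linear bounds on \<open>f\<close> at its zeros,
  \<open>G\<close> diverges logarithmically at both end points, so the solution is global.
\<close>

lemma connecting_orbit_exists:
  fixes f :: "real \<Rightarrow> real"
  assumes ab: "a < b"
    and cont: "\<And>y. a < y \<Longrightarrow> y < b \<Longrightarrow> isCont f y"
    and neg: "\<And>y. a < y \<Longrightarrow> y < b \<Longrightarrow> f y < 0"
    and L: "L > 0"
    and lower: "\<And>y. a < y \<Longrightarrow> y < b \<Longrightarrow> - f y \<le> L * (y - a)"
    and upper: "\<And>y. a < y \<Longrightarrow> y < b \<Longrightarrow> - f y \<le> L * (b - y)"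
  shows "\<exists>v. (\<forall>t. a < v t \<and> v t < b \<and> (v has_real_derivative f (v t)) (at t)) \<and>
    (v \<longlongrightarrow> b) at_bot \<and> (v \<longlongrightarrow> a) at_top"
proof -
  have "\<exists>G. \<forall>x::real. ereal a < ereal x \<longrightarrow> ereal x < ereal b \<longrightarrow>
      (G has_vector_derivative 1 / f x) (at x)"
    using ab neg cont by (intro einterval_antiderivative continuous_divide) force+
  then obtain G where G: "\<And>y. a < y \<Longrightarrow> y < b \<Longrightarrow> (G has_real_derivative 1 / f y) (at y)"
    by (auto simp: has_real_derivative_iff_has_vector_derivative)
  have G_cont: "isCont G y" if "a < y" "y < b" for y
    using G[OF that] DERIV_isCont by blast
  have G_less: "G z < G y" if "a < y" "y < z" "z < b" for y z
  proof (rule DERIV_neg_imp_decreasing[OF that(2)])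
    fix x assume "y \<le> x" "x \<le> z"
    then show "\<exists>D. (G has_real_derivative D) (at x) \<and> D < 0"
      using that G[of x] neg[of x] by (intro exI[of _ "1 / f x"]) (auto simp: divide_simps)
  qed
  have G_less_iff: "G z < G y \<longleftrightarrow> y < z" if "a < y" "y < b" "a < z" "z < b" for y z
    using that G_less[of y z] G_less[of z y] by (cases y z rule: linorder_cases) auto
  define m where "m = (a + b) / 2"
  have m: "a < m" "m < b"
    using ab by (auto simp: m_def)
  have above: "\<exists>y. a < y \<and> y < b \<and> G y > t" for t
  proof -
    \<comment> \<open>Since \<open>-f x \<le> L (x - a)\<close>, the function
      \<open>G x + ln (x - a) / L\<close> is nonincreasing. The exponential is chosen so that
      comparison with \<open>m\<close> gives \<open>G y \<ge> t + 1\<close>; the minimum keeps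
      \<open>y\<close> to the left of \<open>m\<close>.\<close>
    define y where "y = min m (a + (m - a) * exp (- (L * (t + 1 - G m))))"
    have y: "a < y" "y \<le> m" "y - a \<le> (m - a) * exp (- (L * (t + 1 - G m)))"
      using m by (auto simp: y_def)
    have "G m + ln (m - a) / L \<le> G y + ln (y - a) / L"
    proof (rule DERIV_nonpos_imp_nonincreasing[OF y(2)])
      fix x assume x: "y \<le> x" "x \<le> m"
      with y m have x': "a < x" "x < b" by auto
      have "((\<lambda>x. G x + ln (x - a) / L) has_real_derivative 1 / f x + 1 / (x - a) / L) (at x)"
        using x' L G[OF x'] by (auto intro!: derivative_eq_intros)
      moreover have "1 / f x + 1 / (x - a) / L \<le> 0"
        using neg[OF x'] lower[OF x'] x' L by (simp add: field_simps)
      ultimately show "\<exists>D. ((\<lambda>x. G x + ln (x - a) / L) has_real_derivative D) (at x) \<and> D \<le> 0"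
        by blast
    qed
    moreover have "ln (y - a) \<le> ln ((m - a) * exp (- (L * (t + 1 - G m))))"
      using y m by simp
    then have "ln (y - a) \<le> ln (m - a) - L * (t + 1 - G m)"
      using m by (simp add: ln_mult)
    then have "ln (y - a) / L \<le> ln (m - a) / L - (t + 1 - G m)"
      using L by (simp add: field_simps)
    ultimately show ?thesis using y m by (intro exI[of _ y]) auto
  qed
  have below: "\<exists>y. a < y \<and> y < b \<and> G y < t" for t
  proof -
    \<comment> \<open>Mirror image at \<open>b\<close>: \<open>G x - ln (b - x) / L\<close> is
      nonincreasing, and this choice gives \<open>G y \<le> t - 1\<close>.\<close>
    define y where "y = max m (b - (b - m) * exp (- (L * (G m - t + 1))))"
    have y: "y < b" "m \<le> y" "b - y \<le> (b - m) * exp (- (L * (G m - t + 1)))"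
      using m by (auto simp: y_def)
    have "G y - ln (b - y) / L \<le> G m - ln (b - m) / L"
    proof (rule DERIV_nonpos_imp_nonincreasing[OF y(2)])
      fix x assume x: "m \<le> x" "x \<le> y"
      with y m have x': "a < x" "x < b" by auto
      have "((\<lambda>x. G x - ln (b - x) / L) has_real_derivative 1 / f x + 1 / (b - x) / L) (at x)"
        using x' L G[OF x'] by (auto intro!: derivative_eq_intros simp: divide_simps)
      moreover have "1 / f x + 1 / (b - x) / L \<le> 0"
        using neg[OF x'] upper[OF x'] x' L by (simp add: field_simps)
      ultimately show "\<exists>D. ((\<lambda>x. G x - ln (b - x) / L) has_real_derivative D) (at x) \<and> D \<le> 0"
        by blast
    qed
    moreover have "ln (b - y) \<le> ln ((b - m) * exp (- (L * (G m - t + 1))))"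
      using y m by simp
    then have "ln (b - y) \<le> ln (b - m) - L * (G m - t + 1)"
      using m by (simp add: ln_mult)
    then have "ln (b - y) / L \<le> ln (b - m) / L - (G m - t + 1)"
      using L by (simp add: field_simps)
    ultimately show ?thesis using y m by (intro exI[of _ y]) auto
  qed
  have "\<exists>y. a < y \<and> y < b \<and> G y = t" for t
  proof -
    obtain y z where y: "a < y" "y < b" "G y > t" and z: "a < z" "z < b" "G z < t"
      using above below by blast
    then have "y < z"
      using G_less_iff[of y z] by auto
    then have "\<exists>x. y \<le> x \<and> x \<le> z \<and> G x = t"
      using y z G_cont by (intro IVT2) auto
    then obtain x where "y \<le> x" "x \<le> z" "G x = t"
      by blast
    then show ?thesis using y z by (intro exI[of _ x]) auto
  qed
  then obtain v where v: "\<And>t. a < v t" "\<And>t. v t < b" "\<And>t. G (v t) = t"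
    by metis
  have v_G: "v (G y) = y" if "a < y" "y < b" for y
    using G_less_iff[OF v(1,2) that, of "G y"] G_less_iff[OF that v(1,2), of "G y"] v(3) by force
  have v_cont: "isCont v t" for t
  proof -
    \<comment> \<open>Half the distance from \<open>v t\<close> to the end points: the closed
      \<open>e\<close>-neighbourhood lies in the open interval, where \<open>v\<close> inverts
      \<open>G\<close>.\<close>
    define e where "e = min (v t - a) (b - v t) / 2"
    have "isCont v (G (v t))"
    proof (rule isCont_inverse_function[where d = e and f = G])
      show "0 < e"
        using v by (simp add: e_def)
      fix z assume "\<bar>z - v t\<bar> \<le> e"
      moreover have "e < v t - a" "e < b - v t"
        using v(1,2)[of t] by (auto simp: e_def)
      ultimately have "a < z" "z < b" by auto
      then show "v (G z) = z" "isCont G z"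
        using v_G G_cont by auto
    qed
    then show ?thesis by (simp add: v)
  qed
  \<comment> \<open>The inverse of a function with derivative \<open>1/f\<close> has derivative
    \<open>f\<close>. The window from \<open>t - 1\<close> to \<open>t + 1\<close> is arbitrary, as
    \<open>G (v t) = t\<close> holds for all \<open>t\<close>.\<close>
  have v_deriv: "(v has_real_derivative f (v t)) (at t)" for t
    using DERIV_inverse_function[where f = G and g = v, OF G[OF v(1,2)], of t "t - 1" "t + 1"]
      neg[OF v(1,2), of t] v_cont v(3)
    by simp
  \<comment> \<open>As \<open>G\<close> is decreasing, comparing \<open>v t\<close> with
    \<open>y\<close> amounts to comparing \<open>t\<close> with \<open>G y\<close>; both limits
    follow from this.\<close>
  have v_less: "v t < y \<longleftrightarrow> G y < t" and less_v: "y < v t \<longleftrightarrow> t < G y" if "a < y" "y < b" for y t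
    using G_less_iff[OF v(1,2) that, of t] G_less_iff[OF that v(1,2), of t] v(3) by auto
  have ev_small: "\<forall>\<^sub>F t in at_top. v t < y" if "y > a" for y
  proof (cases "y < b")
    case True
    then show ?thesis using eventually_gt_at_top[of "G y"] that by (simp add: v_less)
  next
    case False
    then show ?thesis using v(2) by (intro always_eventually allI) (meson not_less order.strict_trans2)
  qed
  have ev_large: "\<forall>\<^sub>F t in at_bot. y < v t" if "y < b" for y
  proof (cases "a < y")
    case True
    then show ?thesis using eventually_gt_at_bot[of "G y"] that by (simp add: less_v)
  next
    case False
    then show ?thesis using v(1) by (intro always_eventually allI) (meson not_less order.strict_trans1)
  qed
  have "(v \<longlongrightarrow> b) at_bot"
    by (intro order_tendstoI ev_large always_eventually allI) (use v(2) order.strict_trans in blast)+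
  moreover have "(v \<longlongrightarrow> a) at_top"
    by (intro order_tendstoI ev_small always_eventually allI) (use v(1) order.strict_trans in blast)+
  ultimately show ?thesis
    using v v_deriv by blast
qed

text \<open>By uniqueness, an orbit meeting a zero of \<open>f\<close> is constant and cannot have
  two different limits. So the connected range omits \<open>a\<close> and \<open>b\<close>; as the
  limits give a value above \<open>a\<close> and a value below \<open>b\<close>, no value can lie
  beyond either end.\<close>

lemma connecting_orbit_range:
  fixes f v :: "real \<Rightarrow> real"
  assumes f: "smooth_on {0<..} f" and zeros: "f a = 0" "f b = 0" and ab: "0 < a" "a < b"
    and pos: "\<And>t. v t > 0" and v: "\<And>t. (v has_real_derivative f (v t)) (at t)"
    and lim: "(v \<longlongrightarrow> b) at_bot" "(v \<longlongrightarrow> a) at_top"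
  shows "a < v t \<and> v t < b"
proof -
  have avoid: "v t \<noteq> c" if "f c = 0" "c > 0" for c t
  proof
    assume "v t = c"
    then have "v = (\<lambda>_. c)"
      using that by (intro ode_unique[OF f pos _ v]) auto
    then show False
      using lim ab by (metis tendsto_const_iff trivial_limit_at_bot_linorder
          trivial_limit_at_top_linorder less_irrefl)
  qed
  have cont: "continuous_on A v" for A
    using DERIV_isCont[OF v] by (intro continuous_at_imp_continuous_on) auto
  have conn: "connected (range v)"
    by (intro connected_continuous_image cont connected_UNIV)
  obtain s where s: "v s < b"
    using order_tendstoD(2)[OF lim(2) ab(2)] eventually_happens trivial_limit_at_top_linorder by blast
  obtain r where r: "v r > a"
    using order_tendstoD(1)[OF lim(1) ab(2)] eventually_happens trivial_limit_at_bot_linorder by blast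
  have "b \<notin> range v" "a \<notin> range v"
    using avoid[OF zeros(1)] avoid[OF zeros(2)] ab by fastforce+
  then have "\<not> v t \<le> a" "\<not> b \<le> v t"
    using connectedD_interval[OF conn, of "v t" "v r" a] connectedD_interval[OF conn, of "v s" "v t" b] r s
    by auto
  then show ?thesis by simp
qed

section \<open>Limits of derivatives and convexity\<close>

text \<open>By l'Hopital \<open>u t / t\<close> tends to \<open>d\<close>; because \<open>u\<close>
  converges, it also tends to 0.\<close>

lemma tendsto_deriv_zero:
  fixes u :: "real \<Rightarrow> real"
  assumes u: "\<And>t. (u has_real_derivative u' t) (at t)"
    and lim: "(u \<longlongrightarrow> l) at_top" "(u' \<longlongrightarrow> d) at_top"
  shows "d = 0"
proof -
  have "((\<lambda>t. u t / t) \<longlongrightarrow> d) at_top"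
    by (rule lhospital_at_top_at_top[where f' = u' and g' = "\<lambda>_. 1"])
      (use u lim(2) in \<open>auto simp: filterlim_ident\<close>)
  moreover have "((\<lambda>t. u t / t) \<longlongrightarrow> 0) at_top"
    using lim(1) filterlim_ident by (rule real_tendsto_divide_at_top)
  ultimately show ?thesis
    using tendsto_unique trivial_limit_at_top_linorder by blast
qed

text \<open>The mean slopes left and right of \<open>y\<close> are attained as
  \<open>h' c < h' d\<close>, so the left one is negative or the right one positive; as
  \<open>h\<close> vanishes at both ends, either case forces \<open>h y < 0\<close>.\<close>

lemma strict_convex_neg_between_zeros:
  fixes h :: "real \<Rightarrow> real"
  assumes h: "\<And>x. a \<le> x \<Longrightarrow> x \<le> b \<Longrightarrow> (h has_real_derivative h' x) (at x)"
    and mono: "\<And>x y. a \<le> x \<Longrightarrow> x < y \<Longrightarrow> y \<le> b \<Longrightarrow> h' x < h' y"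
    and zeros: "h a = 0" "h b = 0" and y: "a < y" "y < b"
  shows "h y < 0"
proof -
  obtain c where c: "a < c" "c < y" "h y - h a = (y - a) * h' c"
    using MVT2[of a y h h'] h y by force
  obtain d where d: "y < d" "d < b" "h b - h y = (b - y) * h' d"
    using MVT2[of y b h h'] h y by force
  have "h' c < h' d"
    using mono c d by simp
  then have "h' c < 0 \<or> h' d > 0"
    by linarith
  then show ?thesis
  proof
    assume "h' c < 0"
    then have "(y - a) * h' c < 0" using y by (simp add: mult_pos_neg)
    then show ?thesis using c(3) zeros by linarith
  next
    assume "h' d > 0"
    then have "(b - y) * h' d > 0" using y by simp
    then show ?thesis using d(3) zeros by linarith
  qed
qed

text \<open>\<open>deriv f\<close> is nondecreasing. If it failed to grow from \<open>x\<close> to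
  \<open>y\<close>, it would be constant in between, and the second derivative would vanish on a
  whole interval.\<close>

lemma deriv_strict_mono:
  fixes f :: "real \<Rightarrow> real"
  assumes f: "smooth_on {0<..} f"
    and nonneg: "\<And>v. v > 0 \<Longrightarrow> deriv (deriv f) v \<ge> 0"
    and nontrivial: "\<And>a b. 0 < a \<Longrightarrow> a < b \<Longrightarrow> \<exists>v\<in>{a<..<b}. deriv (deriv f) v \<noteq> 0"
    and xy: "0 < x" "x < y"
  shows "deriv f x < deriv f y"
proof (rule ccontr)
  assume "\<not> deriv f x < deriv f y"
  have D: "(deriv f has_real_derivative deriv (deriv f) z) (at z)" if "z > 0" for z
    using DERIV_smooth_on[OF smooth_on_deriv[OF f]] that by simp
  have mono: "deriv f a \<le> deriv f b" if "0 < a" "a \<le> b" for a b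
    by (rule DERIV_nonneg_imp_nondecreasing[OF that(2)]) (meson D nonneg that(1) order.strict_trans2)
  obtain z where z: "x < z" "z < y" "deriv (deriv f) z \<noteq> 0"
    using nontrivial[OF xy] by auto
  have const: "deriv f x = deriv f w" if "w \<in> {x<..<y}" for w
    using mono[of x w] mono[of w y] that xy \<open>\<not> deriv f x < deriv f y\<close> by auto
  have "deriv (deriv f) z = deriv (\<lambda>_. deriv f x) z"
    using z const by (intro deriv_cong_open[of "{x<..<y}"]) auto
  then show False using z by simp
qed

section \<open>Viscous shocks\<close>

text \<open>The reduced vector field, with \<open>c\<close> standing for the right end state
  \<open>v_plus\<close>.\<close>

definition shock_field :: "(real \<Rightarrow> real) \<Rightarrow> (real \<Rightarrow> real) \<Rightarrow> real \<Rightarrow> real \<Rightarrow> real \<Rightarrow> real" where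
  "shock_field p \<mu> s c y = y * (s\<^sup>2 * (y - c) + (p y - p c)) / (- s * \<mu> y)"

lemma smooth_on_shock_field:
  assumes "smooth_on {0<..} p" "smooth_on {0<..} \<mu>" "\<And>v. v > 0 \<Longrightarrow> \<mu> v > 0" "s \<noteq> 0"
  shows "smooth_on {0<..} (shock_field p \<mu> s c)"
proof -
  \<comment> \<open>Differences are written as sums with constants to match the closure
    rules.\<close>
  have "smooth_on {0<..} (\<lambda>y. y * (s\<^sup>2 * (y + - c) + (p y + - p c)) / (- s * \<mu> y))"
    using assms by (intro smooth_on_divide smooth_on_mult smooth_on_add smooth_on_id smooth_on_const)
      (auto simp: less_imp_neq[symmetric] dest: assms(3))
  then show ?thesis by (simp add: shock_field_def[abs_def])
qed

text \<open>
  Integrating the momentum equation once gives \<open>\<mu>(v) u' / v = p(v) - s u - K\<close>. The left side has a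
  limit at \<open>+\<infinity>\<close>, hence so has \<open>u'\<close>; it is zero as \<open>u\<close> converges, which determines \<open>K\<close>.
\<close>

lemma viscous_shock_imp_ode:
  assumes p: "smooth_on {0<..} p" and \<mu>: "smooth_on {0<..} \<mu>" "\<And>v. v > 0 \<Longrightarrow> \<mu> v > 0"
    and s: "s \<noteq> 0" and c: "v_plus > 0"
    and sol: "viscous_shock p \<mu> s v_minus v_plus u_minus u_plus v u"
  shows "(v has_real_derivative shock_field p \<mu> s v_plus (v t)) (at t)"
    and "u t = u_plus - s * (v t - v_plus)"
proof -
  have v: "smooth_on UNIV v" and u: "smooth_on UNIV u" and pos: "\<And>t. v t > 0"
    and mass: "\<And>t. - s * deriv v t - deriv u t = 0"
    and momentum: "\<And>t. - s * deriv u t + deriv (\<lambda>x. p (v x)) t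
      = deriv (\<lambda>x. \<mu> (v x) * deriv u x / v x) t"
    and v_lim: "(v \<longlongrightarrow> v_plus) at_top" and u_lim: "(u \<longlongrightarrow> u_plus) at_top"
    using sol unfolding viscous_shock_def by blast+
  define W where "W x = \<mu> (v x) * deriv u x / v x" for x
  have Dv: "(v has_real_derivative deriv v x) (at x)"
    and Du: "(u has_real_derivative deriv u x) (at x)"
    and Ddu: "(deriv u has_real_derivative deriv (deriv u) x) (at x)" for x
    using DERIV_smooth_on[OF v] DERIV_smooth_on[OF u] DERIV_smooth_on[OF smooth_on_deriv[OF u]]
    by auto
  have Dpv: "((\<lambda>x. p (v x)) has_real_derivative deriv (\<lambda>x. p (v x)) x) (at x)"
    and D\<mu>v: "((\<lambda>x. \<mu> (v x)) has_real_derivative deriv (\<lambda>x. \<mu> (v x)) x) (at x)" for x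
    using DERIV_chain2[OF DERIV_smooth_on[OF p] Dv, of x] DERIV_chain2[OF DERIV_smooth_on[OF \<mu>(1)] Dv, of x]
      pos[of x] by (auto simp: DERIV_imp_deriv)
  have "W differentiable (at x)" for x
    unfolding W_def using D\<mu>v Ddu Dv pos[of x]
    by (intro differentiable_divide differentiable_mult) (auto simp: real_differentiable_def)
  then have DW: "(W has_real_derivative deriv W x) (at x)" for x
    by (simp add: DERIV_deriv_iff_real_differentiable)
  have mass_int: "u t = u_plus - s * (v t - v_plus)" for t
  proof -
    \<comment> \<open>The mass equation makes \<open>u + s v\<close> constant; its limit at
      \<open>+\<infinity>\<close> gives the value.\<close>
    have const: "u x + s * v x = u t + s * v t" for x
    proof -
      have "\<forall>y. ((\<lambda>x. u x + s * v x) has_real_derivative 0) (at y)"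
      proof
        fix y
        have "deriv u y + s * deriv v y = 0"
          using mass[of y] by simp
        then show "((\<lambda>x. u x + s * v x) has_real_derivative 0) (at y)"
          using DERIV_add[OF Du[of y] DERIV_cmult[OF Dv[of y], of s]] by simp
      qed
      then show ?thesis by (rule DERIV_isconst_all)
    qed
    have "((\<lambda>x. u x + s * v x) \<longlongrightarrow> u_plus + s * v_plus) at_top"
      by (intro tendsto_intros u_lim v_lim)
    then have "((\<lambda>_::real. u t + s * v t) \<longlongrightarrow> u_plus + s * v_plus) at_top"
      by (rule Lim_transform_eventually) (intro always_eventually allI const)
    then have "u t + s * v t = u_plus + s * v_plus"
      by (simp add: tendsto_const_iff)
    then show ?thesis by (simp add: algebra_simps)
  qed
  define K where "K = p (v t) - s * u t - W t"
  have W: "W x = p (v x) - s * u x - K" for x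
  proof -
    have "p (v x) - s * u x - W x = p (v t) - s * u t - W t"
    proof -
      have "\<forall>y. ((\<lambda>x. p (v x) - s * u x - W x) has_real_derivative 0) (at y)"
      proof
        fix y
        have "deriv (\<lambda>x. p (v x)) y - s * deriv u y - deriv W y = 0"
          using momentum[of y] unfolding W_def[symmetric] by simp
        then show "((\<lambda>x. p (v x) - s * u x - W x) has_real_derivative 0) (at y)"
          using DERIV_diff[OF DERIV_diff[OF Dpv[of y] DERIV_cmult[OF Du[of y], of s]] DW[of y]] by simp
      qed
      then show ?thesis by (rule DERIV_isconst_all)
    qed
    then show ?thesis by (simp add: K_def)
  qed
  \<comment> \<open>Solving the integrated momentum equation for \<open>u'\<close> expresses it
    through \<open>u\<close> and \<open>v\<close> alone, so their convergence carries over to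
    \<open>u'\<close>.\<close>
  have du: "deriv u x = (p (v x) - s * u x - K) * v x / \<mu> (v x)" for x
    using W[of x] pos[of x] \<mu>(2)[OF pos[of x]] by (simp add: W_def field_simps)
  have "isCont p v_plus" "isCont \<mu> v_plus"
    using c DERIV_isCont[OF DERIV_smooth_on[OF p]] DERIV_isCont[OF DERIV_smooth_on[OF \<mu>(1)]] by auto
  then have "((\<lambda>x. p (v x)) \<longlongrightarrow> p v_plus) at_top" "((\<lambda>x. \<mu> (v x)) \<longlongrightarrow> \<mu> v_plus) at_top"
    using v_lim isCont_tendsto_compose by blast+
  then have "((\<lambda>x. (p (v x) - s * u x - K) * v x / \<mu> (v x)) \<longlongrightarrow>
      (p v_plus - s * u_plus - K) * v_plus / \<mu> v_plus) at_top"
    using \<mu>(2)[OF c] by (intro tendsto_intros u_lim v_lim) auto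
  then have "(deriv u \<longlongrightarrow> (p v_plus - s * u_plus - K) * v_plus / \<mu> v_plus) at_top"
    by (simp add: du[abs_def])
  \<comment> \<open>The limit of \<open>u'\<close> must be 0, and its factor
    \<open>v_plus / \<mu> v_plus\<close> is positive, so the bracket vanishes.\<close>
  from tendsto_deriv_zero[OF Du u_lim this] have K: "K = p v_plus - s * u_plus"
    using c \<mu>(2)[OF c] by simp
  have "deriv v t = deriv u t / (- s)"
    using mass[of t] s by (simp add: field_simps)
  also have "\<dots> = shock_field p \<mu> s v_plus (v t)"
    unfolding du K mass_int[of t] shock_field_def by (simp add: algebra_simps power2_eq_square)
  finally show "(v has_real_derivative shock_field p \<mu> s v_plus (v t)) (at t)"
    using Dv[of t] by simp
  show "u t = u_plus - s * (v t - v_plus)"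
    by (rule mass_int)
qed

text \<open>The affine choice of \<open>u\<close> solves the mass equation. The viscous flux then
  collapses to \<open>h(v)\<close>, whose derivative is
  \<open>s^2 v' + p(v)' = -s u' + p(v)'\<close>. \<open>RH1\<close> gives the left limit of
  \<open>u\<close>.\<close>

lemma ode_imp_viscous_shock:
  assumes p: "smooth_on {0<..} p" and \<mu>: "smooth_on {0<..} \<mu>" "\<And>v. v > 0 \<Longrightarrow> \<mu> v > 0"
    and s: "s \<noteq> 0" and pos: "\<And>t. v t > 0"
    and RH1: "- s * (v_plus - v_minus) = u_plus - u_minus"
    and ode: "\<And>t. (v has_real_derivative shock_field p \<mu> s v_plus (v t)) (at t)"
    and lim: "(v \<longlongrightarrow> v_minus) at_bot" "(v \<longlongrightarrow> v_plus) at_top"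
  shows "viscous_shock p \<mu> s v_minus v_plus u_minus u_plus v (\<lambda>t. u_plus - s * (v t - v_plus))"
proof -
  define u where "u = (\<lambda>t. u_plus - s * (v t - v_plus))"
  have v: "smooth_on UNIV v"
    using smooth_on_ode_solution[OF smooth_on_shock_field[OF p \<mu> s] _ _ ode] pos by simp
  have "smooth_on UNIV (\<lambda>t. (u_plus + s * v_plus) + (- s) * v t)"
    by (intro smooth_on_add smooth_on_mult smooth_on_const v) auto
  then have u: "smooth_on UNIV u"
    by (simp add: u_def algebra_simps)
  have dv: "deriv v t = shock_field p \<mu> s v_plus (v t)" for t
    using ode by (rule DERIV_imp_deriv)
  have du: "deriv u t = - s * deriv v t" for t
    unfolding u_def by (rule DERIV_imp_deriv) (auto intro!: derivative_eq_intros ode simp: dv)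
  have W: "(\<lambda>x. \<mu> (v x) * deriv u x / v x) = (\<lambda>x. s\<^sup>2 * (v x - v_plus) + (p (v x) - p v_plus))"
  proof
    fix x
    show "\<mu> (v x) * deriv u x / v x = s\<^sup>2 * (v x - v_plus) + (p (v x) - p v_plus)"
      unfolding du dv shock_field_def using s pos[of x] \<mu>(2)[OF pos[of x]] by simp
  qed
  have "- s * deriv u t + deriv (\<lambda>x. p (v x)) t = deriv (\<lambda>x. \<mu> (v x) * deriv u x / v x) t" for t
  proof -
    have Dp: "((\<lambda>x. p (v x)) has_real_derivative deriv (\<lambda>x. p (v x)) t) (at t)"
      using DERIV_chain2[OF DERIV_smooth_on[OF p] ode, of t] pos[of t] by (simp add: DERIV_imp_deriv)
    have "((\<lambda>x. s\<^sup>2 * (v x - v_plus) + (p (v x) - p v_plus)) has_real_derivative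
        s\<^sup>2 * deriv v t + deriv (\<lambda>x. p (v x)) t) (at t)"
      by (auto intro!: derivative_eq_intros ode Dp simp: dv)
    then show ?thesis
      unfolding W by (simp add: DERIV_imp_deriv du power2_eq_square)
  qed
  moreover have "(u \<longlongrightarrow> u_plus - s * (v_minus - v_plus)) at_bot" "(u \<longlongrightarrow> u_plus - s * (v_plus - v_plus)) at_top"
    unfolding u_def by (intro tendsto_intros lim)+
  moreover have "u_plus - s * (v_minus - v_plus) = u_minus"
    using RH1 by (simp add: algebra_simps)
  ultimately show ?thesis
    unfolding viscous_shock_def u_def[symmetric] using v u pos lim du by simp
qed

section \<open>Existence, uniqueness up to a shift, and monotonicity\<close>

theorem theorem1:
  fixes p \<mu> :: "real \<Rightarrow> real"
    and v_minus v_plus u_minus u_plus s :: real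
  assumes p_smooth: "smooth_on {0<..} p" and mu_smooth: "smooth_on {0<..} \<mu>"
    and p_pos: "\<And>v. v > 0 \<Longrightarrow> p v > 0" and mu_pos: "\<And>v. v > 0 \<Longrightarrow> \<mu> v > 0"
    and p'_neg: "\<And>v. v > 0 \<Longrightarrow> deriv p v < 0"
    and p''_nonneg: "\<And>v. v > 0 \<Longrightarrow> deriv (deriv p) v \<ge> 0"
    and p''_nontrivial: "\<And>a b. 0 < a \<Longrightarrow> a < b \<Longrightarrow> \<exists>v\<in>{a<..<b}. deriv (deriv p) v \<noteq> 0"
    and v_pos: "v_minus > 0" "v_plus > 0"
    and s_neg: "s < 0"
    and RH1: "- s * (v_plus - v_minus) = u_plus - u_minus"
    and RH2: "- s * (u_plus - u_minus) = - (p v_plus - p v_minus)"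
    and entropy: "v_minus > v_plus" "u_minus > u_plus"
  shows "(\<exists>v u. viscous_shock p \<mu> s v_minus v_plus u_minus u_plus v u) \<and>
         (\<forall>v u w z. viscous_shock p \<mu> s v_minus v_plus u_minus u_plus v u \<longrightarrow>
            viscous_shock p \<mu> s v_minus v_plus u_minus u_plus w z \<longrightarrow>
            (\<exists>\<alpha>. \<forall>\<xi>. w \<xi> = v (\<xi> + \<alpha>) \<and> z \<xi> = u (\<xi> + \<alpha>))) \<and>
         (\<forall>v u. viscous_shock p \<mu> s v_minus v_plus u_minus u_plus v u \<longrightarrow>
            (\<forall>\<xi>. deriv u \<xi> \<le> 0))"
proof -
  define f where "f = shock_field p \<mu> s v_plus"
  define h where "h y = s\<^sup>2 * (y - v_plus) + (p y - p v_plus)" for y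
  have f_eq: "f y = y * h y / (- s * \<mu> y)" for y
    by (simp add: f_def shock_field_def h_def)
  have s: "s \<noteq> 0"
    using s_neg by simp
  have f_smooth: "smooth_on {0<..} f"
    unfolding f_def using p_smooth mu_smooth mu_pos s by (rule smooth_on_shock_field)
  \<comment> \<open>Eliminating the velocities from the Rankine-Hugoniot conditions leaves exactly
    \<open>h v_minus = 0\<close>.\<close>
  have "s\<^sup>2 * (v_minus - v_plus) = - (p v_minus - p v_plus)"
    using RH2 unfolding RH1[symmetric] by (simp add: algebra_simps power2_eq_square)
  then have h_zeros: "h v_plus = 0" "h v_minus = 0"
    by (simp_all add: h_def)
  then have f_zeros: "f v_plus = 0" "f v_minus = 0"
    by (simp_all add: f_eq)
  have f_neg: "f y < 0" if y: "v_plus < y" "y < v_minus" for y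
  proof -
    have "h y < 0"
    proof (rule strict_convex_neg_between_zeros[OF _ _ h_zeros y])
      show "(h has_real_derivative s\<^sup>2 + deriv p x) (at x)" if "v_plus \<le> x" for x
        unfolding h_def using that v_pos
        by (auto intro!: derivative_eq_intros DERIV_smooth_on[OF p_smooth])
      show "s\<^sup>2 + deriv p x < s\<^sup>2 + deriv p z" if "v_plus \<le> x" "x < z" for x z
        using deriv_strict_mono[OF p_smooth p''_nonneg p''_nontrivial, of x z] that v_pos by simp
    qed
    then have "y * h y < 0" "0 < - s * \<mu> y"
      using y v_pos mu_pos[of y] s_neg by (auto simp: mult_less_0_iff)
    then show ?thesis
      unfolding f_eq by (rule divide_neg_pos)
  qed
  have solution: "(v has_real_derivative f (v t)) (at t)" "u t = u_plus - s * (v t - v_plus)"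
      "v_plus < v t \<and> v t < v_minus"
    if "viscous_shock p \<mu> s v_minus v_plus u_minus u_plus v u" for v u t
  proof -
    have ode: "(v has_real_derivative f (v t)) (at t)" for t
      unfolding f_def using p_smooth mu_smooth mu_pos s v_pos(2) that by (rule viscous_shock_imp_ode(1))
    then show "(v has_real_derivative f (v t)) (at t)" .
    show "u t = u_plus - s * (v t - v_plus)"
      using p_smooth mu_smooth mu_pos s v_pos(2) that by (rule viscous_shock_imp_ode(2))
    show "v_plus < v t \<and> v t < v_minus"
      using that unfolding viscous_shock_def
      by (intro connecting_orbit_range[OF f_smooth f_zeros v_pos(2) entropy(1) _ ode]) auto
  qed
  have existence: "\<exists>v u. viscous_shock p \<mu> s v_minus v_plus u_minus u_plus v u"
  proof -
    have "{v_plus..v_minus} \<subseteq> {0<..}"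
      using v_pos(2) by auto
    then obtain L where L: "L > 0"
        "\<And>x y. x \<in> {v_plus..v_minus} \<Longrightarrow> y \<in> {v_plus..v_minus} \<Longrightarrow> \<bar>f x - f y\<bar> \<le> L * \<bar>x - y\<bar>"
      using smooth_on_imp_lipschitz[OF f_smooth] by meson
    have "\<exists>v. (\<forall>t. v_plus < v t \<and> v t < v_minus \<and> (v has_real_derivative f (v t)) (at t)) \<and>
        (v \<longlongrightarrow> v_minus) at_bot \<and> (v \<longlongrightarrow> v_plus) at_top"
    proof (rule connecting_orbit_exists[OF entropy(1) _ f_neg L(1)])
      fix y assume y: "v_plus < y" "y < v_minus"
      show "isCont f y"
        using DERIV_isCont[OF DERIV_smooth_on[OF f_smooth]] y v_pos by simp
      \<comment> \<open>Lipschitz bound against the two zeros of \<open>f\<close>.\<close>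
      show "- f y \<le> L * (y - v_plus)" "- f y \<le> L * (v_minus - y)"
        using L(2)[of y v_plus] L(2)[of y v_minus] y f_zeros by auto
    qed
    then obtain v where v: "\<And>t. v_plus < v t \<and> v t < v_minus"
        "\<And>t. (v has_real_derivative f (v t)) (at t)"
        "(v \<longlongrightarrow> v_minus) at_bot" "(v \<longlongrightarrow> v_plus) at_top"
      by blast
    have "viscous_shock p \<mu> s v_minus v_plus u_minus u_plus v (\<lambda>t. u_plus - s * (v t - v_plus))"
    proof (rule ode_imp_viscous_shock[OF p_smooth mu_smooth mu_pos s _ RH1])
      show "v t > 0" for t
        using v(1)[of t] v_pos by simp
    qed (use v(2-4) in \<open>auto simp: f_def\<close>)
    then show ?thesis by blast
  qed
  have uniqueness: "\<exists>\<alpha>. \<forall>\<xi>. w \<xi> = v (\<xi> + \<alpha>) \<and> z \<xi> = u (\<xi> + \<alpha>)"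
    if vu: "viscous_shock p \<mu> s v_minus v_plus u_minus u_plus v u"
      and wz: "viscous_shock p \<mu> s v_minus v_plus u_minus u_plus w z" for v u w z
  proof -
    note v = solution[OF vu] and w = solution[OF wz]
    have "(v \<longlongrightarrow> v_minus) at_bot" "(v \<longlongrightarrow> v_plus) at_top"
      using vu by (auto simp: viscous_shock_def)
    \<comment> \<open>\<open>w 0\<close> lies strictly between the limits of \<open>v\<close>, so
      \<open>v\<close> attains it at some time \<open>\<alpha>\<close>, which is the required
      shift.\<close>
    then have "\<forall>\<^sub>F t in at_bot. w 0 < v t" "\<forall>\<^sub>F t in at_top. v t < w 0"
      using w(3)[of 0] by (auto intro: order_tendstoD)
    then obtain a b where ab: "w 0 < v a" "v b < w 0"
      using eventually_happens trivial_limit_at_bot_linorder trivial_limit_at_top_linorder by metis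
    have "connected (range v)"
      using DERIV_isCont[OF v(1)]
      by (intro connected_continuous_image continuous_at_imp_continuous_on) auto
    then have "w 0 \<in> range v"
      using ab by (auto dest: connectedD_interval[of "range v" "v b" "v a" "w 0"])
    then obtain \<alpha> where \<alpha>: "w 0 = v (0 + \<alpha>)"
      by auto
    have "w = (\<lambda>\<xi>. v (\<xi> + \<alpha>))"
    proof (rule ode_unique[where f = f and v = w and w = "\<lambda>\<xi>. v (\<xi> + \<alpha>)" and a = 0, OF f_smooth _ _ w(1) _ \<alpha>])
      show "w x > 0" "v (x + \<alpha>) > 0" for x
        using w(3)[of x] v(3)[of "x + \<alpha>"] v_pos by auto
      show "((\<lambda>\<xi>. v (\<xi> + \<alpha>)) has_real_derivative f (v (x + \<alpha>))) (at x)" for x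
        using v(1)[of "x + \<alpha>"] by (simp add: DERIV_shift)
    qed
    \<comment> \<open>The velocities follow, being the same affine function of \<open>v\<close> and
      \<open>w\<close>.\<close>
    then show ?thesis
      using v(2) w(2) by metis
  qed
  have monotone: "deriv u \<xi> \<le> 0"
    if vu: "viscous_shock p \<mu> s v_minus v_plus u_minus u_plus v u" for v u \<xi>
  proof -
    \<comment> \<open>The mass equation reads \<open>u' = -s v'\<close>, where \<open>-s > 0\<close>
      and \<open>v' = f(v) < 0\<close>.\<close>
    have "- s * deriv v \<xi> - deriv u \<xi> = 0"
      using vu by (auto simp: viscous_shock_def)
    moreover have "deriv v \<xi> < 0"
      using DERIV_imp_deriv[OF solution(1)[OF vu]] f_neg solution(3)[OF vu] by simp
    ultimately show ?thesis
      using mult_pos_neg[of "- s" "deriv v \<xi>"] s_neg by simp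
  qed
  show ?thesis
    using existence uniqueness monotone by blast
qed

end
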